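(* Fix $n\ge1$, and for $k\in\{1,\dots,n\}$ let $b_k=b_{n,k}$, so that for all $m\ge n$ $$c_{n,m}(1)=\sum_{k=1}^{n} b_k\binom{m-1}{k-1}.$$ Then: (a) $b_k$ is a positive integer for all $k\in\{1,\dots,n\}$; (b) $b_1=1$; (c) $b_2=\binom{n}{\lfloor n/2\rfloor}-1$; (d) $b_n=1$.
   Context: Words are finite sequences of positive integers; $|w|$ is the length of $w$. $P(w)$ is the insertion tableau of $w$ under the Robinson–Schensted–Knuth (row-insertion) correspondence, and $C(u)=\{w : P(uw)=P(wu)\}$ (juxtaposition is concatenation). $c_{n,m}(u)=\#\{w\in C(u): |w|=n,\ \max w\le m\}$. A word $w$ is $k$-packed if $\max w=k$ and every element of $\{1,\dots,k\}$ occurs in $w$. $b_{n,k}$ is the number of $k$-packed words $w\in C(1)$ with $|w|=n$. *)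

theory Defs
  imports Main
begin

text \<open>Words are lists of positive naturals. The maximum of the empty word is taken to be 0.\<close>

definition is_word :: "nat list \<Rightarrow> bool" where
  "is_word w \<longleftrightarrow> (\<forall>x\<in>set w. 1 \<le> x)"

definition word_max :: "nat list \<Rightarrow> nat" where
  "word_max w = Max (insert 0 (set w))"

text \<open>Row insertion replaces the leftmost entry strictly greater than \<open>x\<close>, returning the
  bumped entry, or appends \<open>x\<close> if there is none. Tableaux are lists of rows, top row first.\<close>

fun row_insert :: "nat \<Rightarrow> nat list \<Rightarrow> nat list \<times> nat option" where
  "row_insert x [] = ([x], None)"
| "row_insert x (y # ys) =
     (if x < y then (x # ys, Some y)
      else (let (r, b) = row_insert x ys in (y # r, b)))"

fun tableau_insert :: "nat \<Rightarrow> nat list list \<Rightarrow> nat list list" where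
  "tableau_insert x [] = [[x]]"
| "tableau_insert x (r # rs) =
     (case row_insert x r of
        (r', None) \<Rightarrow> r' # rs
      | (r', Some y) \<Rightarrow> r' # tableau_insert y rs)"

text \<open>The letters of the word are inserted from left to right.\<close>

definition insertion_tableau :: "nat list \<Rightarrow> nat list list" where
  "insertion_tableau w = fold tableau_insert w []"

definition plactic_centralizer :: "nat list \<Rightarrow> nat list set" where
  "plactic_centralizer u =
     {w. is_word w \<and> insertion_tableau (u @ w) = insertion_tableau (w @ u)}"

definition centralizer_count :: "nat \<Rightarrow> nat \<Rightarrow> nat list \<Rightarrow> nat" where
  "centralizer_count n m u =
     card {w \<in> plactic_centralizer u. length w = n \<and> word_max w \<le> m}"

definition packed :: "nat \<Rightarrow> nat list \<Rightarrow> bool" where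
  "packed k w \<longleftrightarrow> is_word w \<and> word_max w = k \<and> {1..k} \<subseteq> set w"

definition packed_count :: "nat \<Rightarrow> nat \<Rightarrow> nat" where
  "packed_count n k = card {w \<in> plactic_centralizer [1]. packed k w \<and> length w = n}"

end

theory Submission
  imports Defs "HOL-Library.Infinite_Set" "HOL-Library.FuncSet"
begin

text \<open>Prepending the least letter \<open>1\<close> to a word merely prepends \<open>1\<close> to the first row of its
  insertion tableau, because this entry is never bumped. Inserting \<open>1\<close> at the end lengthens the
  first row only if that row consists of \<open>1\<close>s. Hence \<open>C(1)\<close> consists of the words whose first row
  is constantly \<open>1\<close>. This condition is invariant under increasing relabellings of the
  alphabet that fix \<open>1\<close>, which gives the binomial expansion. On words over \<open>{1, 2}\<close>, the number of
  \<open>2\<close>s in the first row performs a walk reflected at \<open>0\<close>, whose returns to \<open>0\<close> are counted by central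
  binomial coefficients.\<close>

declare One_nat_def [simp del]

section \<open>The first row of the insertion tableau\<close>

definition row_step :: "nat \<Rightarrow> nat list \<Rightarrow> nat list" where
  "row_step x r = fst (row_insert x r)"

text \<open>The first row evolves without reference to the lower rows, so bumped entries can be
  discarded. Agreement with the actual tableau is \<open>hd_insertion_tableau\<close>.\<close>

definition first_row :: "nat list \<Rightarrow> nat list" where
  "first_row w = fold row_step w []"

lemma row_step_simps [simp]:
  "row_step x [] = [x]"
  "row_step x (y # ys) = (if x < y then x # ys else y # row_step x ys)"
  by (simp_all add: row_step_def split_beta)

lemma first_row_Nil [simp]: "first_row [] = []"
  by (simp add: first_row_def)

lemma first_row_snoc [simp]: "first_row (w @ [x]) = row_step x (first_row w)"
  by (simp add: first_row_def)

lemma set_row_step: "x \<in> set (row_step x r)" "set (row_step x r) \<subseteq> insert x (set r)"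
  by (induction r) auto

lemma set_first_row: "set (first_row w) \<subseteq> set w"
  by (induction w rule: rev_induct) (use set_row_step in fastforce)+

lemma row_step_neq_Nil [simp]: "row_step x r \<noteq> []"
  by (cases r) auto

lemma first_row_eq_Nil_iff [simp]: "first_row w = [] \<longleftrightarrow> w = []"
  by (cases w rule: rev_cases) auto

lemma length_row_step_ge: "length r \<le> length (row_step x r)"
  by (induction r) auto

lemma count_list_row_step: "count_list (row_step x r) y \<le> count_list (x # r) y"
  by (induction r) auto

text \<open>An insertion adds one copy of the new letter to the first row and otherwise only bumps
  entries out. For \<open>y = 1\<close> this bounds the length of a constant first row.\<close>

lemma count_list_first_row: "count_list (first_row w) y \<le> count_list w y"
proof (induction w rule: rev_induct)
  case (snoc x w)
  then show ?case
    using count_list_row_step[of x "first_row w" y] by (auto split: if_splits)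
qed simp

lemma count_list_constant: "set r \<subseteq> {y} \<Longrightarrow> count_list r y = length r"
  by (induction r) auto

section \<open>The centralizer of the letter 1\<close>

lemma insertion_tableau_Nil [simp]: "insertion_tableau [] = []"
  by (simp add: insertion_tableau_def)

lemma insertion_tableau_snoc [simp]:
  "insertion_tableau (w @ [x]) = tableau_insert x (insertion_tableau w)"
  by (simp add: insertion_tableau_def)

lemma tableau_insert_neq_Nil [simp]: "tableau_insert x t \<noteq> []"
  by (cases t) (auto split: prod.splits option.splits)

lemma insertion_tableau_eq_Nil_iff [simp]: "insertion_tableau w = [] \<longleftrightarrow> w = []"
  by (cases w rule: rev_cases) auto

lemma hd_tableau_insert: "hd (tableau_insert x t) = row_step x (if t = [] then [] else hd t)"
  by (cases t) (auto simp: row_step_def split: prod.splits option.splits)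

lemma hd_insertion_tableau: "w \<noteq> [] \<Longrightarrow> hd (insertion_tableau w) = first_row w"
  by (induction w rule: rev_induct) (auto simp: hd_tableau_insert)

text \<open>Bumping needs a strictly larger entry, so \<open>x\<close> passes over the leading
  \<open>1\<close> and then bumps the same entry as before; the lower rows see no
  difference.\<close>

lemma tableau_insert_Cons_1:
  assumes "1 \<le> x" and "t \<noteq> []"
  shows "tableau_insert x ((1 # hd t) # tl t) =
    (1 # hd (tableau_insert x t)) # tl (tableau_insert x t)"
  using assms by (cases t) (auto split: prod.splits option.splits)

lemma insertion_tableau_Cons_1:
  assumes "is_word w" and "w \<noteq> []"
  shows "insertion_tableau (1 # w) =
    (1 # hd (insertion_tableau w)) # tl (insertion_tableau w)"
  using assms
proof (induction w rule: rev_induct)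
  case (snoc x w)
  have *: "1 \<le> x" "is_word w" using snoc.prems by (auto simp: is_word_def)
  show ?case
  proof (cases "w = []")
    case True
    then show ?thesis using * by (simp add: insertion_tableau_def)
  next
    case False
    have "insertion_tableau (1 # w @ [x]) = tableau_insert x (insertion_tableau (1 # w))"
      using insertion_tableau_snoc[of "1 # w" x] by simp
    then show ?thesis
      using snoc.IH * False tableau_insert_Cons_1[of x "insertion_tableau w"] by simp
  qed
qed simp

lemma row_insert_1_ones:
  "set r \<subseteq> {1} \<Longrightarrow> row_insert 1 r = (1 # r, None)"
  by (induction r) auto

text \<open>The entry \<open>x\<close> guarantees that the inserted \<open>1\<close> bumps something
  instead of being appended.\<close>

lemma length_row_step_1:
  "\<lbrakk>x \<in> set r; 1 < x\<rbrakk> \<Longrightarrow> length (row_step 1 r) = length r"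
  by (induction r) auto

text \<open>A \<open>1\<close> put in front always lengthens the first row, while a \<open>1\<close>
  put at the end does so only if it bumps nothing. Comparing first-row lengths gives one direction.
  In the other, a row of \<open>1\<close>s just grows and the lower rows stay put. The empty word is
  separate because \<open>hd\<close> and \<open>tl\<close> need a nonempty tableau.\<close>

theorem plactic_centralizer_1_iff:
  "w \<in> plactic_centralizer [1] \<longleftrightarrow> is_word w \<and> set (first_row w) \<subseteq> {1}"
proof (cases "is_word w \<and> w \<noteq> []")
  case True
  then have word: "is_word w" and ne: "w \<noteq> []" by auto
  obtain r rs where t: "insertion_tableau w = r # rs"
    using ne by (cases "insertion_tableau w") auto
  have r: "r = first_row w"
    using hd_insertion_tableau[OF ne] t by simp
  have "w \<in> plactic_centralizer [1] \<longleftrightarrow> (1 # r) # rs = tableau_insert 1 (r # rs)"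
    using word insertion_tableau_Cons_1[OF word ne] t by (simp add: plactic_centralizer_def)
  also have "\<dots> \<longleftrightarrow> set r \<subseteq> {1}"
  proof
    assume "(1 # r) # rs = tableau_insert 1 (r # rs)"
    then have eq: "1 # r = row_step 1 r"
      using hd_tableau_insert[of 1 "r # rs"] by (metis list.sel(1) list.discI)
    show "set r \<subseteq> {1}"
    proof
      fix x assume x: "x \<in> set r"
      then have "1 \<le> x"
        using word r set_first_row[of w] by (auto simp: is_word_def)
      moreover have "\<not> 1 < x"
        using length_row_step_1[OF x] eq by (metis length_Cons n_not_Suc_n)
      ultimately show "x \<in> {1}" by simp
    qed
  next
    assume "set r \<subseteq> {1}"
    then show "(1 # r) # rs = tableau_insert 1 (r # rs)"
      using row_insert_1_ones[of r] by simp
  qed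
  finally show ?thesis using word r by simp
next
  case False
  then show ?thesis by (auto simp: plactic_centralizer_def insertion_tableau_def)
qed

lemma plactic_centralizer_1_mem:
  assumes "w \<in> plactic_centralizer [1]" and "w \<noteq> []"
  shows "1 \<in> set w"
  using assms set_first_row[of w]
  by (cases "first_row w") (auto simp: plactic_centralizer_1_iff)

section \<open>Relabelling and the binomial expansion\<close>

lemma row_step_map:
  assumes "strict_mono_on A f" and "x \<in> A" and "set r \<subseteq> A"
  shows "row_step (f x) (map f r) = map f (row_step x r)"
  using assms(3) by (induction r) (use assms(1,2) in \<open>auto simp: strict_mono_on_less\<close>)

text \<open>Row insertion depends only on comparisons between letters, and these survive a strictly
  increasing relabelling.\<close>

lemma first_row_map:
  assumes "strict_mono_on A f" and "set w \<subseteq> A"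
  shows "first_row (map f w) = map f (first_row w)"
  using assms(2)
proof (induction w rule: rev_induct)
  case (snoc x w)
  then show ?case
    using row_step_map[OF assms(1), of x "first_row w"] set_first_row[of w] by auto
qed simp

text \<open>Prescribing the exact support makes the classes for different \<open>S\<close> disjoint,
  with packed words as the case \<open>S = {1..k}\<close>.\<close>

definition commuting_words :: "nat \<Rightarrow> nat set \<Rightarrow> nat list set" where
  "commuting_words n S = {w \<in> plactic_centralizer [1]. length w = n \<and> set w = S}"

lemma finite_commuting_words: "finite S \<Longrightarrow> finite (commuting_words n S)"
  by (rule finite_subset[OF _ finite_lists_length_eq[of S n]])
    (auto simp: commuting_words_def)

lemma packed_count_eq:
  assumes "k \<ge> 1"
  shows "packed_count n k = card (commuting_words n {1..k})"
proof -
  have "packed k w \<longleftrightarrow> set w = {1..k}" if "is_word w" for w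
  proof
    assume "packed k w"
    then show "set w = {1..k}" by (auto simp: packed_def word_max_def is_word_def)
  next
    assume *: "set w = {1..k}"
    have "Max (insert 0 {1..k}) = k"
      using assms by (intro Max_eqI) auto
    with * that show "packed k w" by (auto simp: packed_def word_max_def)
  qed
  then show ?thesis
    unfolding packed_count_def commuting_words_def
    by (intro arg_cong[where f = card]) (auto simp: plactic_centralizer_def)
qed

text \<open>The increasing bijection from \<open>{1..k}\<close> onto \<open>S\<close> fixes
  \<open>1\<close>, so it preserves the property that the first row is constantly \<open>1\<close>.
  Applied letterwise, it matches the packed words with the words of support
  \<open>S\<close>.\<close>

lemma card_commuting_words:
  assumes "finite S" and "1 \<in> S" and "0 \<notin> S"
  shows "card (commuting_words n S) = packed_count n (card S)"
proof -
  define k where "k = card S"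
  have k: "k \<ge> 1" using assms unfolding k_def by (metis One_nat_def Suc_leI card_gt_0_iff empty_iff)
  obtain h where h: "bij_betw h {..<k} S" "strict_mono_on {..<k} h"
    using ex_bij_betw_strict_mono_card[OF assms(1)] unfolding k_def by blast
  \<comment> \<open>The enumeration \<open>h\<close> starts at index 0, whereas letters start at
    1.\<close>
  define f where "f i = h (i - 1)" for i
  have mono: "strict_mono_on {1..k} f"
    unfolding f_def by (rule strict_mono_onI, rule strict_mono_onD[OF h(2)]) auto
  have "bij_betw (\<lambda>i. i - 1) {1..k} {..<k}"
    by (rule bij_betwI[where g = Suc]) auto
  from bij_betw_trans[OF this h(1)] have bij: "bij_betw f {1..k} S"
    by (simp add: f_def[abs_def] comp_def)
  have inj: "inj_on f {1..k}" and img: "f ` {1..k} = S"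
    using bij by (auto simp: bij_betw_def)
  \<comment> \<open>By monotonicity \<open>f 1\<close> is the least element of \<open>S\<close>,
    which is \<open>1\<close> because \<open>1\<close> lies in \<open>S\<close> and \<open>0\<close>
    does not.\<close>
  have f1: "f 1 = 1"
  proof -
    obtain i where i: "i \<in> {1..k}" "f i = 1" using img assms(2) by force
    have "f 1 \<le> f i"
      using strict_mono_on_leD[OF mono, of 1 i] i k by simp
    moreover have "f 1 \<in> S" using img k by force
    ultimately show ?thesis using i assms(3) by (cases "f 1") auto
  qed
  have mem_iff: "map f w \<in> plactic_centralizer [1] \<longleftrightarrow> w \<in> plactic_centralizer [1]"
    if w: "set w = {1..k}" for w
  proof -
    have "is_word w" using w by (auto simp: is_word_def)
    moreover have "is_word (map f w)"
    proof -
      have "set (map f w) = S" using w img by simp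
      then show ?thesis using assms(3) unfolding is_word_def by (metis less_one not_less)
    qed
    moreover have "set (first_row (map f w)) \<subseteq> {1} \<longleftrightarrow> set (first_row w) \<subseteq> {1}"
    proof -
      have "f x = 1 \<longleftrightarrow> x = 1" if "x \<in> set (first_row w)" for x
        using that set_first_row[of w] w k f1 inj_onD[OF inj, of x 1] by auto
      then show ?thesis
        using first_row_map[OF mono, of w] w by auto
    qed
    ultimately show ?thesis by (simp add: plactic_centralizer_1_iff)
  qed
  have "bij_betw (map f) (commuting_words n {1..k}) (commuting_words n S)"
  proof (rule bij_betw_imageI)
    show "inj_on (map f) (commuting_words n {1..k})"
      by (rule inj_on_subset[OF inj_on_mapI[of f "{w. set w = {1..k}}"]])
        (use inj in \<open>auto simp: commuting_words_def\<close>)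
    show "map f ` commuting_words n {1..k} = commuting_words n S"
    proof (intro subset_antisym subsetI)
      fix v assume "v \<in> map f ` commuting_words n {1..k}"
      then show "v \<in> commuting_words n S"
        using mem_iff img by (auto simp: commuting_words_def)
    next
      fix v assume v: "v \<in> commuting_words n S"
      define g where "g = inv_into {1..k} f"
      have v': "v = map f (map g v)"
        using v img by (auto simp: commuting_words_def g_def f_inv_into_f intro!: map_idI[symmetric])
      moreover have "set (map g v) = {1..k}"
        using v bij_betw_inv_into[OF bij] by (simp add: commuting_words_def g_def bij_betw_def)
      ultimately have "map g v \<in> commuting_words n {1..k}"
        using v mem_iff[of "map g v"] by (auto simp: commuting_words_def)
      with v' show "v \<in> map f ` commuting_words n {1..k}" by blast
    qed
  qed
  then show ?thesis
    using packed_count_eq[OF k, of n] by (simp add: bij_betw_same_card k_def)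
qed

text \<open>Removing the compulsory element \<open>1\<close> leaves an arbitrary subset of
  \<open>{2..m}\<close> of size \<open>k - 1\<close>.\<close>

lemma card_supports:
  assumes "m \<ge> 1" and "k \<ge> 1"
  shows "card {S. S \<subseteq> {1..m} \<and> 1 \<in> S \<and> card S = k} = (m - 1) choose (k - 1)"
proof -
  have "bij_betw (insert 1) {S. S \<subseteq> {2..m} \<and> card S = k - 1}
      {S. S \<subseteq> {1..m} \<and> 1 \<in> S \<and> card S = k}"
  proof (rule bij_betwI[where g = "\<lambda>S. S - {1}"])
    show "insert 1 \<in> {S. S \<subseteq> {2..m} \<and> card S = k - 1} \<rightarrow>
        {S. S \<subseteq> {1..m} \<and> 1 \<in> S \<and> card S = k}"
    proof
      fix S assume S: "S \<in> {S. S \<subseteq> {2..m} \<and> card S = k - 1}"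
      then have "finite S" "1 \<notin> S" by (auto intro: finite_subset)
      with S assms show "insert 1 S \<in> {S. S \<subseteq> {1..m} \<and> 1 \<in> S \<and> card S = k}" by force
    qed
    show "(\<lambda>S. S - {1}) \<in> {S. S \<subseteq> {1..m} \<and> 1 \<in> S \<and> card S = k} \<rightarrow>
        {S. S \<subseteq> {2..m} \<and> card S = k - 1}"
      by (fastforce simp: numeral_2_eq_2)
  qed (fastforce)+
  then have "card {S. S \<subseteq> {1..m} \<and> 1 \<in> S \<and> card S = k} = card {S. S \<subseteq> {2..m} \<and> card S = k - 1}"
    by (simp add: bij_betw_same_card)
  then show ?thesis by (simp add: n_subsets)
qed

text \<open>The words are split by support. A support contains \<open>1\<close> and has at most
  \<open>n\<close> elements, and its contribution depends only on its size, so grouping by size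
  produces the binomial coefficients.\<close>

lemma centralizer_count_1:
  assumes "n \<ge> 1" and "m \<ge> 1"
  shows "centralizer_count n m [1] =
    (\<Sum>k=1..n. packed_count n k * ((m - 1) choose (k - 1)))"
proof -
  define \<S> where "\<S> = {S. S \<subseteq> {1..m} \<and> 1 \<in> S \<and> card S \<in> {1..n}}"
  have fin: "finite \<S>" by (rule finite_subset[of _ "Pow {1..m}"]) (auto simp: \<S>_def)
  have "{w \<in> plactic_centralizer [1]. length w = n \<and> word_max w \<le> m} =
      (\<Union>S\<in>\<S>. commuting_words n S)" (is "?L = ?R")
  proof (intro subset_antisym subsetI)
    fix w assume w: "w \<in> ?L"
    then have "1 \<in> set w" using assms plactic_centralizer_1_mem by force
    moreover have "set w \<subseteq> {1..m}"
      using w by (auto simp: plactic_centralizer_def is_word_def word_max_def)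
    moreover have "card (set w) \<in> {1..n}"
    proof -
      have "0 < card (set w)" using \<open>1 \<in> set w\<close> by (auto simp: card_gt_0_iff)
      then show ?thesis using w card_length[of w] by (simp add: Suc_le_eq One_nat_def)
    qed
    ultimately show "w \<in> ?R" using w by (auto simp: \<S>_def commuting_words_def)
  next
    fix w assume "w \<in> ?R"
    then show "w \<in> ?L" by (auto simp: \<S>_def commuting_words_def word_max_def)
  qed
  then have "centralizer_count n m [1] = card (\<Union>S\<in>\<S>. commuting_words n S)"
    by (simp add: centralizer_count_def)
  also have "\<dots> = (\<Sum>S\<in>\<S>. card (commuting_words n S))"
  proof (rule card_UN_disjoint[OF fin])
    show "\<forall>S\<in>\<S>. finite (commuting_words n S)"
      by (auto simp: \<S>_def intro!: finite_commuting_words intro: finite_subset)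
  qed (auto simp: commuting_words_def)
  also have "\<dots> = (\<Sum>S\<in>\<S>. packed_count n (card S))"
    by (intro sum.cong card_commuting_words) (auto simp: \<S>_def intro: finite_subset)
  also have "\<dots> = (\<Sum>k=1..n. \<Sum>S | S \<in> \<S> \<and> card S = k. packed_count n (card S))"
    using fin by (subst sum.group) (auto simp: \<S>_def)
  also have "\<dots> = (\<Sum>k=1..n. packed_count n k * ((m - 1) choose (k - 1)))"
  proof (intro sum.cong refl)
    fix k assume k: "k \<in> {1..n}"
    then have "{S. S \<in> \<S> \<and> card S = k} = {S. S \<subseteq> {1..m} \<and> 1 \<in> S \<and> card S = k}"
      by (auto simp: \<S>_def)
    with k show "(\<Sum>S | S \<in> \<S> \<and> card S = k. packed_count n (card S)) =
        packed_count n k * ((m - 1) choose (k - 1))"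
      using card_supports[of m k] assms by simp
  qed
  finally show ?thesis .
qed

section \<open>Packed words: the extreme values of k, and positivity\<close>

lemma first_row_replicate_1: "first_row (replicate n 1) = replicate n 1"
proof (induction n)
  case (Suc n)
  have "row_step 1 (replicate n 1) = replicate (Suc n) 1"
    using row_insert_1_ones[of "replicate n 1"] by (simp add: row_step_def set_replicate_conv_if)
  then show ?case
    using Suc first_row_snoc[of "replicate n 1" 1] by (simp add: replicate_append_same)
qed simp

lemma packed_count_1:
  assumes "n \<ge> 1"
  shows "packed_count n 1 = 1"
proof -
  have "commuting_words n {1..1} = {replicate n 1}"
    using assms first_row_replicate_1[of n]
    by (auto simp: commuting_words_def plactic_centralizer_1_iff is_word_def
        replicate_length_same[symmetric] set_replicate_conv_if)
  then show ?thesis by (simp add: packed_count_eq)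
qed

text \<open>Each new letter is smaller than the only entry of the row and replaces it.\<close>

lemma fold_row_step_decreasing:
  "sorted_wrt (>) (x # w) \<Longrightarrow> fold row_step w [x] = [last (x # w)]"
  by (induction w arbitrary: x) auto

lemma first_row_decreasing:
  "\<lbrakk>sorted_wrt (>) w; w \<noteq> []\<rbrakk> \<Longrightarrow> first_row w = [last w]"
  using fold_row_step_decreasing by (cases w) (auto simp: first_row_def)

text \<open>A case of Schensted's theorem on weakly increasing subsequences. Row lengths never
  shrink, so every prefix also has a short first row. By induction its only entry is the last letter
  read, and the next letter must bump it.\<close>

lemma decreasing_if_length_first_row:
  "length (first_row w) \<le> 1 \<Longrightarrow> sorted_wrt (>) w"
proof (induction w rule: rev_induct)
  case (snoc x w)
  have "length (first_row w) \<le> 1"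
    using snoc.prems length_row_step_ge[of "first_row w" x] by simp
  then have dec: "sorted_wrt (>) w" by (rule snoc.IH)
  show ?case
  proof (cases w rule: rev_cases)
    case (snoc v y)
    then have "first_row w = [y]" using first_row_decreasing[OF dec] by simp
    then have "x < y" using snoc.prems by (simp split: if_splits)
    then show ?thesis using dec snoc by (auto simp: sorted_wrt_append)
  qed simp
qed simp

text \<open>A word of length \<open>n\<close> using all of \<open>{1..n}\<close> has exactly one
  \<open>1\<close>. A first row of \<open>1\<close>s then has length at most one, which forces the
  decreasing word.\<close>

lemma packed_count_self:
  assumes "n \<ge> 1"
  shows "packed_count n n = 1"
proof -
  let ?d = "rev [1..<Suc n]"
  have dec: "sorted_wrt (>) ?d" by (simp add: sorted_wrt_rev del: upt_Suc)
  have "last ?d = 1" using assms by (simp add: last_rev upt_rec[of 1] del: upt_Suc)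
  then have "first_row ?d = [1]" using first_row_decreasing[OF dec] assms by simp
  then have d: "?d \<in> commuting_words n {1..n}"
    by (auto simp: commuting_words_def plactic_centralizer_1_iff is_word_def simp del: upt_Suc)
  have "w = ?d" if w: "w \<in> commuting_words n {1..n}" for w
  proof -
    have w': "set w = {1..n}" "length w = n" "set (first_row w) \<subseteq> {1}"
      using w by (auto simp: commuting_words_def plactic_centralizer_1_iff)
    then have dist: "distinct w" by (simp add: card_distinct)
    have "length (first_row w) = count_list (first_row w) 1"
      using w'(3) by (rule count_list_constant[symmetric])
    also have "\<dots> \<le> count_list w 1" by (rule count_list_first_row)
    also have "\<dots> \<le> 1" using dist by (induction w) auto
    finally have "sorted_wrt (>) w" by (rule decreasing_if_length_first_row)
    then have "sorted_wrt (<) (rev w)" by (simp add: sorted_wrt_rev)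
    then have "rev w = [1..<Suc n]"
      by (intro strict_sorted_equal) (use w' in \<open>auto simp del: upt_Suc\<close>)
    then show ?thesis by (metis rev_rev_ident)
  qed
  with d have "commuting_words n {1..n} = {?d}" by blast
  then show ?thesis using assms by (simp add: packed_count_eq)
qed

text \<open>The witness reads \<open>k, ..., 2, 1\<close> and then only \<open>1\<close>s: the
  decreasing part leaves the first row \<open>[1]\<close>, and further \<open>1\<close>s keep it
  constant.\<close>

lemma packed_count_pos:
  assumes "k \<in> {1..n}"
  shows "packed_count n k > 0"
proof -
  let ?w = "rev [1..<Suc k] @ replicate (n - k) 1"
  have dec: "sorted_wrt (>) (rev [1..<Suc k])" by (simp add: sorted_wrt_rev del: upt_Suc)
  have "last (rev [1..<Suc k]) = 1" using assms by (simp add: last_rev upt_rec[of 1] del: upt_Suc)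
  then have row: "first_row (rev [1..<Suc k]) = [1]" using first_row_decreasing[OF dec] assms by simp
  have "set (first_row (rev [1..<Suc k] @ replicate j 1)) \<subseteq> {1}" for j
  proof (induction j)
    case (Suc j)
    have "rev [1..<Suc k] @ replicate (Suc j) 1 = (rev [1..<Suc k] @ replicate j 1) @ [1]"
      by (simp add: replicate_append_same)
    then show ?case
      using Suc set_row_step(2)[of 1 "first_row (rev [1..<Suc k] @ replicate j 1)"]
      by (metis first_row_snoc insert_is_Un sup.order_iff)
  qed (use row in simp)
  then have "?w \<in> commuting_words n {1..k}"
    using assms by (auto simp: commuting_words_def plactic_centralizer_1_iff is_word_def simp del: upt_Suc)
  then have "card (commuting_words n {1..k}) > 0"
    using finite_commuting_words by (metis card_gt_0_iff empty_iff finite_atLeastAtMost)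
  then show ?thesis using assms by (simp add: packed_count_eq)
qed

section \<open>Words over two letters and the reflected walk\<close>

lemma row_step_1_two_letters:
  "row_step 1 (replicate a 1 @ replicate b 2) = replicate (Suc a) 1 @ replicate (b - 1) 2"
  by (induction a) (cases b; simp)+

lemma row_step_2_two_letters:
  "row_step 2 (replicate a 1 @ replicate b 2) = replicate a 1 @ replicate (Suc b) 2"
proof (induction a)
  case 0
  show ?case by (induction b) auto
qed simp

text \<open>Walks of \<open>n\<close> steps from height \<open>b\<close> that end at height 0, the
  height being the number of \<open>2\<close>s in the row. The letter \<open>2\<close> steps up and
  \<open>1\<close> steps down; at height 0 the letter \<open>1\<close> stays there, which is the
  truncated \<open>b - 1\<close> in the recursion.\<close>

definition returning_words :: "nat \<Rightarrow> nat \<Rightarrow> nat \<Rightarrow> nat list set" where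
  "returning_words n a b = {w. set w \<subseteq> {1, 2} \<and> length w = n \<and>
     set (fold row_step w (replicate a 1 @ replicate b 2)) \<subseteq> {1}}"

lemma finite_returning_words: "finite (returning_words n a b)"
  by (rule finite_subset[OF _ finite_lists_length_eq[of "{1, 2}" n]])
    (auto simp: returning_words_def)

lemma returning_words_Suc:
  "returning_words (Suc n) a b =
     Cons 1 ` returning_words n (Suc a) (b - 1) \<union> Cons 2 ` returning_words n a (Suc b)"
proof (intro subset_antisym subsetI)
  fix w assume w: "w \<in> returning_words (Suc n) a b"
  then obtain x v where "w = x # v" by (cases w) (auto simp: returning_words_def)
  with w show "w \<in> Cons 1 ` returning_words n (Suc a) (b - 1) \<union> Cons 2 ` returning_words n a (Suc b)"
    unfolding returning_words_def
    by (auto simp: row_step_1_two_letters row_step_2_two_letters simp del: replicate_Suc)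
next
  fix w assume "w \<in> Cons 1 ` returning_words n (Suc a) (b - 1) \<union> Cons 2 ` returning_words n a (Suc b)"
  then show "w \<in> returning_words (Suc n) a b"
    unfolding returning_words_def
    by (auto simp: row_step_1_two_letters row_step_2_two_letters simp del: replicate_Suc)
qed

text \<open>The recursion at height 0, where the walk either stays or moves to height 1. For even
  \<open>n\<close> it is Pascal's rule; for odd \<open>n\<close> Pascal's rule is combined with the
  symmetry of the two middle coefficients. The value 0 at \<open>n = 0\<close> reflects that height
  1 cannot return in no steps.\<close>

lemma central_binomial_step:
  "(n choose (n div 2)) + (if n = 0 then 0 else n choose ((n - 1) div 2)) =
    (Suc n choose (Suc n div 2))"
proof (cases "even n")
  case True
  then obtain p where "n = 2 * p" by (elim evenE)
  then show ?thesis by (cases p) auto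
next
  case False
  then obtain p where n: "n = Suc (2 * p)" by (elim oddE) simp
  have "n choose Suc p = n choose p"
    using n binomial_symmetric[of "Suc p" n] by simp
  with n show ?thesis by simp
qed

text \<open>Induction on the number of steps, splitting off the first letter; \<open>a\<close> and
  \<open>b\<close> stay arbitrary because that letter changes the starting row.\<close>

lemma card_returning_words:
  "card (returning_words n a b) = (if b \<le> n then n choose ((n - b) div 2) else 0)"
proof (induction n arbitrary: a b)
  case 0
  have "returning_words 0 a b = (if b = 0 then {[]} else {})"
    by (auto simp: returning_words_def)
  then show ?case by simp
next
  case (Suc n)
  have "card (returning_words (Suc n) a b) =
      card (returning_words n (Suc a) (b - 1)) + card (returning_words n a (Suc b))"
    unfolding returning_words_Suc
    by (subst card_Un_disjoint) (auto simp: finite_returning_words card_image)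
  also have "\<dots> = (if b \<le> Suc n then Suc n choose ((Suc n - b) div 2) else 0)"
  proof (cases "b = 0")
    case True
    then show ?thesis using central_binomial_step[of n] by (auto simp: Suc.IH Suc_le_eq One_nat_def)
  next
    case False
    consider "b > Suc n" | "b = Suc n" | "b = n" | "b < n" by linarith
    then show ?thesis
    proof cases
      \<comment> \<open>Only here are both terms nonzero. Their lower indices are consecutive, so
        Pascal's rule applies.\<close>
      case 4
      then have "(n - (b - 1)) div 2 = Suc ((n - Suc b) div 2)"
        "(Suc n - b) div 2 = Suc ((n - Suc b) div 2)"
        using False by presburger+
      moreover have "b - 1 \<le> n" using 4 by simp
      ultimately show ?thesis using 4 by (simp add: Suc.IH)
    qed (use False in \<open>auto simp: Suc.IH\<close>)
  qed
  finally show ?case .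
qed

text \<open>Starting from the empty row, the walks ending at height 0 are the words of
  \<open>C(1)\<close> over \<open>{1, 2}\<close>. Since \<open>n\<close> is positive each contains a
  \<open>1\<close>, so the one word that is not 2-packed is the constant word of
  \<open>1\<close>s.\<close>

lemma packed_count_2:
  assumes "n \<ge> 1"
  shows "packed_count n 2 = (n choose (n div 2)) - 1"
proof -
  have "commuting_words n {1..2} = returning_words n 0 0 - {replicate n 1}"
  proof (intro subset_antisym subsetI)
    fix w assume w: "w \<in> commuting_words n {1..2}"
    then have "2 \<in> set w" by (simp add: commuting_words_def)
    then have "w \<noteq> replicate n 1" by auto
    with w show "w \<in> returning_words n 0 0 - {replicate n 1}"
      by (auto simp: commuting_words_def returning_words_def plactic_centralizer_1_iff first_row_def)
  next
    fix w assume w: "w \<in> returning_words n 0 0 - {replicate n 1}"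
    then have w': "w \<in> plactic_centralizer [1]" "set w \<subseteq> {1, 2}" "length w = n"
      by (auto simp: returning_words_def plactic_centralizer_1_iff first_row_def is_word_def)
    have "1 \<in> set w" using w' assms plactic_centralizer_1_mem by force
    moreover have "2 \<in> set w"
    proof (rule ccontr)
      assume "2 \<notin> set w"
      then have "w = replicate (length w) 1"
        using w'(2) by (intro replicate_length_same[symmetric]) auto
      with w w'(3) show False by simp
    qed
    moreover have "{1..2::nat} = {1, 2}" by (auto; presburger)
    ultimately show "w \<in> commuting_words n {1..2}"
      using w' by (auto simp: commuting_words_def)
  qed
  moreover have "replicate n 1 \<in> returning_words n 0 0"
    using first_row_replicate_1[of n] by (auto simp: returning_words_def first_row_def)
  ultimately have "card (commuting_words n {1..2}) = card (returning_words n 0 0) - 1"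
    by (simp add: finite_returning_words)
  then show ?thesis by (simp add: packed_count_eq card_returning_words)
qed

theorem theorem4p5:
  fixes n :: nat
  assumes "n \<ge> 1"
  shows "(\<forall>m\<ge>n. centralizer_count n m [1] =
            (\<Sum>k=1..n. packed_count n k * ((m - 1) choose (k - 1)))) \<and>
         (\<forall>k\<in>{1..n}. packed_count n k > 0) \<and>
         packed_count n 1 = 1 \<and>
         packed_count n 2 = (n choose (n div 2)) - 1 \<and>
         packed_count n n = 1"
  using assms centralizer_count_1 packed_count_pos packed_count_1 packed_count_2
    packed_count_self by auto

end
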